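(* Let $1\leq p<\infty$ and $a<p-1$. For any measurable $f\colon[0,\infty)\to\mathbb{R}$ such that $H(|f|)(1)<\infty$ and $H^*(|f|)(1)<\infty$, $$\int_0^\infty|Hf(t)|^pt^a\,dt\leq C_{p,a}^p\int_0^\infty|H^*f(t)|^pt^a\,dt.$$ The constant is best possible, i.e. $C_{p,a}^p$ cannot be replaced by a smaller constant.
   Context: $Hf(t)=\frac1t\int_0^tf(s)\,ds$ and $H^*f(t)=\int_t^\infty\frac{f(s)}{s}\,ds$ for $t>0$. The conditions $H(|f|)(1)<\infty$ and $H^*(|f|)(1)<\infty$ guarantee that $Hf$ and $H^*f$ are well defined on $(0,\infty)$. For $1\le p<\infty$ and $a<p-1$, $C_{p,a}$ denotes the smallest constant $K$ such that $$\int_0^\infty|Hg(t)-g(t)|^p t^a\,dt\le K^p\int_0^\infty|g(t)|^pt^a\,dt$$ for all measurable $g\colon[0,\infty)\to\mathbb{R}$ for which the right-hand side is finite (such $g$ are automatically locally integrable on $[0,\infty)$). *)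

theory Defs
  imports "HOL-Analysis.Analysis"
begin

text \<open>
  A function on \<open>[0, \<infinity>)\<close> is represented by a total function \<open>real \<Rightarrow> real\<close> of which only the
  restriction to \<open>{0..}\<close> is used. Measurability is Lebesgue measurability.
\<close>

definition hardy :: "(real \<Rightarrow> real) \<Rightarrow> real \<Rightarrow> real" where
  "hardy f t = (1 / t) * (LINT s:{0..t}|lebesgue. f s)"

definition hardy_adj :: "(real \<Rightarrow> real) \<Rightarrow> real \<Rightarrow> real" where
  "hardy_adj f t = (LINT s:{t..}|lebesgue. f s / s)"

text \<open>
  The Bochner integral of a non-integrable function is 0, so the finiteness conditions
  \<open>H(|f|)(1) < \<infinity>\<close> and \<open>H\<^sup>*(|f|)(1) < \<infinity>\<close> are stated with the extended-valued versions of
  the two operators on nonnegative functions.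
\<close>

definition nn_hardy :: "(real \<Rightarrow> ennreal) \<Rightarrow> real \<Rightarrow> ennreal" where
  "nn_hardy F t = ennreal (1 / t) * (\<integral>\<^sup>+ s\<in>{0..t}. F s \<partial>lebesgue)"

definition nn_hardy_adj :: "(real \<Rightarrow> ennreal) \<Rightarrow> real \<Rightarrow> ennreal" where
  "nn_hardy_adj F t = (\<integral>\<^sup>+ s\<in>{t..}. F s / ennreal s \<partial>lebesgue)"

definition admissible :: "(real \<Rightarrow> real) \<Rightarrow> bool" where
  "admissible f \<longleftrightarrow>
     f \<in> borel_measurable (lebesgue_on {0..}) \<and>
     nn_hardy (\<lambda>s. ennreal \<bar>f s\<bar>) 1 < \<infinity> \<and>
     nn_hardy_adj (\<lambda>s. ennreal \<bar>f s\<bar>) 1 < \<infinity>"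

definition weighted_integral :: "real \<Rightarrow> real \<Rightarrow> (real \<Rightarrow> real) \<Rightarrow> ennreal" where
  "weighted_integral p a u = (\<integral>\<^sup>+ t\<in>{0<..}. ennreal (\<bar>u t\<bar> powr p * t powr a) \<partial>lebesgue)"

definition hardy_minus_id_bound :: "real \<Rightarrow> real \<Rightarrow> real \<Rightarrow> bool" where
  "hardy_minus_id_bound p a K \<longleftrightarrow>
     (\<forall>g. g \<in> borel_measurable (lebesgue_on {0..}) \<longrightarrow> weighted_integral p a g < \<infinity> \<longrightarrow>
        weighted_integral p a (\<lambda>t. hardy g t - g t)
          \<le> ennreal (K powr p) * weighted_integral p a g)"

text \<open>
  Only \<open>K \<ge> 0\<close> is considered, as \<open>K powr p\<close> does not have its usual meaning for negative \<open>K\<close>.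
  A least such \<open>K\<close> exists for \<open>1 \<le> p\<close> and \<open>a < p - 1\<close>: Hardy's inequality gives some bound,
  and the set of bounds is closed.
\<close>

definition C_const :: "real \<Rightarrow> real \<Rightarrow> real" where
  "C_const p a = (LEAST K. 0 \<le> K \<and> hardy_minus_id_bound p a K)"

end

theory Submission
  imports Defs
begin

text \<open>
  If \<open>g = H\<^sup>* f\<close>, then Fubini's theorem gives \<open>H g = H f + H\<^sup>* f\<close>, that is, \<open>H f = H g - g\<close>. The
  inequality is therefore the one defining \<open>C\<close>, applied to \<open>g\<close>; when the norm of \<open>g\<close> is infinite,
  it holds because \<open>C > 0\<close>.

  For sharpness, suppose that the inequality holds with \<open>B\<close> in place of \<open>C\<^sup>p\<close>. Then the norm
  inequality between \<open>H g - g\<close> and \<open>g\<close> with constant \<open>B\<close> holds for all \<open>g = H\<^sup>* f\<close> with \<open>f\<close> admissible,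
  and by Fatou's lemma it survives dominated a.e. limits. A continuous \<open>\<phi>\<close> with compact support in
  \<open>(0, \<infinity>)\<close> is the limit of its moving averages over \<open>[t, t + h]\<close>, which are \<open>H\<^sup>* f\<close> for
  \<open>f(s) = s (\<phi>(s) - \<phi>(s + h)) / h\<close>. Every bounded \<open>g\<close> with compact support in \<open>(0, \<infinity>)\<close> is a dominated
  limit of such \<open>\<phi>\<close>, and every \<open>g\<close> of finite norm is a dominated limit of its truncations, so
  \<open>B \<ge> C\<^sup>p\<close>.
\<close>

section \<open>Reduction to Borel functions\<close>

text \<open>This holds for every \<open>u\<close>: a simple function below the integrand that is
  measurable for the completion becomes Borel after being set to 0 on a null set, and its integral
  stays the same.\<close>

lemma weighted_integral_lborel:
  "weighted_integral p a u = (\<integral>\<^sup>+ t\<in>{0<..}. ennreal (\<bar>u t\<bar> powr p * t powr a) \<partial>lborel)"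
  unfolding weighted_integral_def by (rule nn_integral_completion)

lemma weighted_integral_cong_AE:
  assumes "AE t in lborel. 0 < t \<longrightarrow> u t = v t"
  shows "weighted_integral p a u = weighted_integral p a v"
  unfolding weighted_integral_lborel
  by (rule nn_integral_cong_AE) (use assms in \<open>eventually_elim, auto simp: indicator_def\<close>)

lemma weighted_integral_cong:
  "(\<And>t. 0 < t \<Longrightarrow> u t = v t) \<Longrightarrow> weighted_integral p a u = weighted_integral p a v"
  by (rule weighted_integral_cong_AE) auto

lemma weighted_integral_mono:
  assumes "1 \<le> p" "\<And>t. 0 < t \<Longrightarrow> \<bar>u t\<bar> \<le> \<bar>v t\<bar>"
  shows "weighted_integral p a u \<le> weighted_integral p a v"
  unfolding weighted_integral_lborel
  by (rule nn_integral_mono)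
     (use assms in \<open>auto simp: indicator_def intro!: ennreal_leI mult_right_mono powr_mono2\<close>)

lemma hardy_borel:
  assumes "g \<in> borel_measurable borel"
  shows "hardy g t = (1 / t) * (LINT s:{0..t}|lborel. g s)"
  unfolding hardy_def set_lebesgue_integral_def
  by (subst integral_completion) (use assms in auto)

lemma hardy_adj_borel:
  assumes "f \<in> borel_measurable borel"
  shows "hardy_adj f t = (LINT s:{t..}|lborel. f s / s)"
  unfolding hardy_adj_def set_lebesgue_integral_def
  by (subst integral_completion) (use assms in auto)

lemma borel_measurable_hardy [measurable]:
  assumes [measurable]: "g \<in> borel_measurable borel"
  shows "hardy g \<in> borel_measurable borel"
proof -
  have [measurable]: "Measurable.pred (borel \<Otimes>\<^sub>M borel) (\<lambda>(t::real, s::real). s \<in> {0..t})"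
    by (simp add: case_prod_beta)
  have "(\<lambda>t. (1 / t) * (LINT s:{0..t}|lborel. g s)) \<in> borel_measurable borel"
    unfolding set_lebesgue_integral_def by measurable
  then show ?thesis by (simp add: hardy_borel[OF assms] cong: measurable_cong)
qed

lemma borel_measurable_hardy_adj [measurable]:
  assumes [measurable]: "f \<in> borel_measurable borel"
  shows "hardy_adj f \<in> borel_measurable borel"
proof -
  have [measurable]: "Measurable.pred (borel \<Otimes>\<^sub>M borel) (\<lambda>(t::real, s::real). s \<in> {t..})"
    by (simp add: case_prod_beta)
  have "(\<lambda>t. LINT s:{t..}|lborel. f s / s) \<in> borel_measurable borel"
    unfolding set_lebesgue_integral_def by measurable
  then show ?thesis by (simp add: hardy_adj_borel[OF assms] cong: measurable_cong)
qed

text \<open>Both operators see functions only up to null sets. The cutoff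
  \<open>indicator {0..} t * g t\<close> is Lebesgue measurable on the whole line, so it has a Borel
  version. For \<open>hardy_adj\<close> only \<open>0 < t\<close> is considered: for negative
  \<open>t\<close> the range \<open>{t..}\<close> would involve values of \<open>g\<close> outside
  its domain.\<close>

lemma borel_representative:
  fixes g :: "real \<Rightarrow> real"
  assumes g: "g \<in> borel_measurable (lebesgue_on {0..})"
  obtains g' where "g' \<in> borel_measurable borel" "AE t in lborel. 0 \<le> t \<longrightarrow> g t = g' t"
    "\<And>t. hardy g t = hardy g' t" "\<And>t. 0 < t \<Longrightarrow> hardy_adj g t = hardy_adj g' t"
proof -
  have m: "(\<lambda>t. indicator {0..} t * g t) \<in> borel_measurable lebesgue"
    using g by (simp add: borel_measurable_restrict_space_iff)
  from completion_ex_borel_measurable_real[OF m] obtain g'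
    where g' [measurable]: "g' \<in> borel_measurable borel"
      and ae: "AE t in lborel. indicator {0..} t * g t = g' t"
    by auto
  have ae': "AE t in lborel. 0 \<le> t \<longrightarrow> g t = g' t"
    using ae by eventually_elim auto
  have ael: "AE t in lebesgue. 0 \<le> t \<longrightarrow> g t = g' t"
    using ae' by (rule AE_completion)
  have m': "g' \<in> borel_measurable lebesgue"
    by (rule measurable_completion) simp
  have ind: "indicat_real S \<in> borel_measurable lebesgue" if "S \<in> sets borel" for S
    by (rule measurable_completion) (use that in simp)
  have 1: "hardy g t = hardy g' t" for t
  proof -
    have "(\<lambda>s. indicat_real {0..t} s * (indicat_real {0..} s * g s)) \<in> borel_measurable lebesgue"
      by (rule borel_measurable_times[OF ind m]) simp
    also have "(\<lambda>s. indicat_real {0..t} s * (indicat_real {0..} s * g s)) =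
        (\<lambda>s. indicat_real {0..t} s * g s)"
      by (auto simp: indicator_def)
    finally show ?thesis
      unfolding hardy_def set_lebesgue_integral_def
      using borel_measurable_times[OF ind m'] ael
      by (subst integral_cong_AE[where g = "\<lambda>s. indicat_real {0..t} s *\<^sub>R g' s"])
         (auto elim!: eventually_mono simp del: indicator_simps simp: indicator_eq_0_iff split: split_indicator)
  qed
  have 2: "hardy_adj g t = hardy_adj g' t" if "0 < t" for t
  proof -
    have "(\<lambda>s. indicat_real {t..} s * ((indicat_real {0..} s * g s) / s)) \<in> borel_measurable lebesgue"
      by (rule borel_measurable_times[OF ind borel_measurable_divide[OF m]])
        (auto intro: measurable_completion)
    also have "(\<lambda>s. indicat_real {t..} s * ((indicat_real {0..} s * g s) / s)) =
        (\<lambda>s. indicat_real {t..} s * (g s / s))"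
      using that by (auto simp: indicator_def)
    finally show ?thesis
      unfolding hardy_adj_def set_lebesgue_integral_def
      using borel_measurable_times[OF ind borel_measurable_divide[OF m']] ael that
      by (subst integral_cong_AE[where g = "\<lambda>s. indicat_real {t..} s *\<^sub>R (g' s / s)"])
         (auto elim!: eventually_mono intro: measurable_completion simp: indicator_eq_0_iff split: split_indicator)
  qed
  show ?thesis by (rule that[OF g' ae' 1 2])
qed

section \<open>Jensen's inequality with a weight, for the power function\<close>

text \<open>By convexity, \<open>x powr p\<close> lies above its tangent at \<open>m\<close>. This
  is Young's inequality for \<open>x\<close> and \<open>m powr (p - 1)\<close>; the case
  \<open>p = 1\<close> is separate because the conjugate exponent would be infinite.\<close>

lemma powr_tangent_le:
  fixes x m p :: real
  assumes "1 \<le> p" "0 < m" "0 \<le> x"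
  shows "p * m powr (p - 1) * x \<le> x powr p + (p - 1) * m powr p"
proof (cases "p = 1")
  case True
  then show ?thesis using assms by simp
next
  case False
  then have p: "p > 1" using assms by simp
  define q where "q = p / (p - 1)"
  have q: "q > 1" "1 / p + 1 / q = 1" using p by (auto simp: q_def field_simps)
  have "x * m powr (p - 1) \<le> x powr p / p + (m powr (p - 1)) powr q / q"
    using Youngs_inequality[of p q x "m powr (p - 1)"] p q assms by simp
  also have "(m powr (p - 1)) powr q = m powr p"
    using p by (simp add: powr_powr q_def)
  finally have "p * (x * m powr (p - 1)) \<le> p * (x powr p / p + m powr p / q)"
    using p by (intro mult_left_mono) auto
  also have "\<dots> = x powr p + (p - 1) * m powr p"
    using p by (simp add: q_def field_simps)
  finally show ?thesis by (simp add: mult_ac)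
qed

text \<open>
  With \<open>enn2real \<infinity> = 0\<close> the statement is trivial if \<open>w x\<close> is not integrable, so that no integrability
  has to be assumed.
\<close>

lemma powr_nn_integral_le:
  fixes x w :: "'a \<Rightarrow> real"
  assumes p: "1 \<le> p"
    and [measurable]: "x \<in> borel_measurable M" "w \<in> borel_measurable M"
    and x: "\<And>s. 0 \<le> x s" and w: "\<And>s. 0 \<le> w s"
    and W: "(\<integral>\<^sup>+s. ennreal (w s) \<partial>M) = ennreal W" "0 < W"
  shows "ennreal (enn2real (\<integral>\<^sup>+s. ennreal (w s * x s) \<partial>M) powr p)
           \<le> ennreal (W powr (p - 1)) * (\<integral>\<^sup>+s. ennreal (w s * x s powr p) \<partial>M)"
proof -
  define I where "I = (\<integral>\<^sup>+s. ennreal (w s * x s) \<partial>M)"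
  define N where "N = (\<integral>\<^sup>+s. ennreal (w s * x s powr p) \<partial>M)"
  show ?thesis
  \<comment> \<open>In the degenerate case either the left side is 0, which includes
    \<open>I = \<infinity>\<close>, or the right side is infinite because
    \<open>0 < W\<close>.\<close>
  proof (cases "enn2real I = 0 \<or> N = \<infinity>")
    case True
    then show ?thesis
      using W p unfolding I_def[symmetric] N_def[symmetric]
      by (auto simp: ennreal_mult_top)
  next
    case False
    define i where "i = enn2real I"
    have i: "I = ennreal i" "0 < i"
      using False enn2real_nonneg[of I] unfolding i_def
      by (auto simp: less_le intro!: ennreal_enn2real[symmetric] elim: contrapos_np)
    obtain n where n: "N = ennreal n" "0 \<le> n" using False by (cases N) auto
    \<comment> \<open>\<open>m\<close> is the weighted mean of \<open>x\<close>, so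
      \<open>x - m\<close> integrates to 0 against \<open>w\<close>, and integrating the tangent
      inequality at \<open>m\<close> leaves Jensen's inequality.\<close>
    define m where "m = i / W"
    have m: "0 < m" using i W by (simp add: m_def)
    have "ennreal (p * m powr (p - 1)) * I = (\<integral>\<^sup>+s. ennreal (w s * (p * m powr (p - 1) * x s)) \<partial>M)"
      unfolding I_def using p x w
      by (subst nn_integral_cmult[symmetric]) (auto simp: ennreal_mult'[symmetric] mult_ac)
    also have "\<dots> \<le> (\<integral>\<^sup>+s. ennreal (w s * (x s powr p + (p - 1) * m powr p)) \<partial>M)"
      using powr_tangent_le[OF p m x] w by (intro nn_integral_mono ennreal_leI mult_left_mono) auto
    also have "\<dots> = (\<integral>\<^sup>+s. ennreal (w s * x s powr p) + ennreal ((p - 1) * m powr p) * ennreal (w s) \<partial>M)"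
      using p w by (intro nn_integral_cong)
        (simp add: ennreal_mult'[symmetric] ennreal_plus[symmetric] distrib_left mult_ac del: ennreal_plus)
    also have "\<dots> = N + ennreal ((p - 1) * m powr p) * ennreal W"
      unfolding N_def W(1)[symmetric] by (subst nn_integral_add) (auto simp: nn_integral_cmult)
    finally have "ennreal (p * m powr (p - 1) * i) \<le> ennreal (n + (p - 1) * m powr p * W)"
      using i n p W m by (simp add: ennreal_mult'[symmetric] ennreal_plus[symmetric] del: ennreal_plus)
    then have "p * m powr (p - 1) * i \<le> n + (p - 1) * m powr p * W"
      using n p W by (subst (asm) ennreal_le_iff) auto
    moreover have "m powr (p - 1) * i = m powr p * W"
    proof -
      have "i = m * W" using W by (simp add: m_def)
      then show ?thesis using m by (simp add: powr_diff)
    qed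
    ultimately have "m powr p * W \<le> n"
      by (simp only: mult.assoc left_diff_distrib mult_1_left distrib_left)
    \<comment> \<open>Since \<open>m * W = i\<close>, this factor turns the left side into
      \<open>i powr p\<close>.\<close>
    then have "W powr (p - 1) * (m powr p * W) \<le> W powr (p - 1) * n"
      by (intro mult_left_mono) auto
    moreover have "W powr (p - 1) * (m powr p * W) = i powr p"
      using i W by (simp add: m_def powr_divide powr_diff)
    ultimately have "ennreal (i powr p) \<le> ennreal (W powr (p - 1)) * ennreal n"
      using n by (simp add: ennreal_mult'[symmetric] ennreal_leI)
    then show ?thesis
      unfolding I_def[symmetric] N_def[symmetric] i_def[symmetric] n by simp
  qed
qed

section \<open>Hardy's inequality\<close>

text \<open>For \<open>p > 1\<close> the exponent must lie strictly between
  \<open>a / (p - 1)\<close> and 1, and the midpoint is taken. For \<open>p = 1\<close> the second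
  condition reads \<open>a < 0\<close>, which is the hypothesis.\<close>

lemma ex_weight_exponent:
  fixes p a :: real
  assumes "1 \<le> p" "a < p - 1"
  obtains b where "b < 1" "a < b * (p - 1)"
proof (cases "p = 1")
  case True
  then show ?thesis using that[of 0] assms by simp
next
  case False
  define c where "c = a / (p - 1)"
  have c: "c < 1" "a = c * (p - 1)" using False assms by (simp_all add: c_def)
  have "c * (p - 1) < (c + 1) / 2 * (p - 1)"
    using c(1) False assms by (intro mult_strict_right_mono) auto
  then show ?thesis using that[of "(c + 1) / 2"] c by simp
qed

lemma nn_integral_powr_from_0:
  fixes b t :: real
  assumes "b < 1" "0 \<le> t"
  shows "(\<integral>\<^sup>+s. ennreal (indicator {0..t} s * s powr - b) \<partial>lborel) = ennreal (t powr (1 - b) / (1 - b))"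
  using nn_integral_has_integral_lebesgue[OF _ has_integral_powr_from_0[of "-b" t]] assms
  by simp

lemma nn_integral_powr_to_inf:
  fixes e s :: real
  assumes "e < - 1" "0 < s"
  shows "(\<integral>\<^sup>+t. ennreal (indicator {s..} t * t powr e) \<partial>lborel) = ennreal (s powr (e + 1) / - (e + 1))"
  using nn_integral_has_integral_lebesgue[OF _ has_integral_powr_to_inf[of e s]] assms
  by (simp add: minus_divide_right)

text \<open>For integrable \<open>u\<close> this is the triangle inequality; otherwise the left side
  is the default value 0.\<close>

lemma abs_integral_le_enn2real:
  fixes u :: "'a \<Rightarrow> real"
  shows "\<bar>LINT s|M. u s\<bar> \<le> enn2real (\<integral>\<^sup>+s. ennreal \<bar>u s\<bar> \<partial>M)"
proof (cases "integrable M u")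
  case True
  have "\<bar>LINT s|M. u s\<bar> \<le> (LINT s|M. \<bar>u s\<bar>)" by (rule integral_abs_bound)
  also have "\<dots> = enn2real (\<integral>\<^sup>+s. ennreal \<bar>u s\<bar> \<partial>M)"
    by (rule integral_eq_nn_integral) (use True in auto)
  finally show ?thesis .
next
  case False
  then show ?thesis by (simp add: not_integrable_integral_eq)
qed

text \<open>
  Jensen's inequality for the weight \<open>s powr - b\<close> on \<open>{0..t}\<close>. Any \<open>b < 1\<close> makes the weight integrable at 0,
  and \<open>a < b * (p - 1)\<close> makes the resulting power of \<open>t\<close> integrable at infinity.
\<close>

lemma hardy_powr_le:
  assumes [measurable]: "g \<in> borel_measurable borel" and p: "1 \<le> p" and b: "b < 1" and t: "0 < t"
  shows "ennreal (\<bar>hardy g t\<bar> powr p * t powr a)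
    \<le> ennreal ((1 - b) powr (1 - p) * t powr (a - 1 - b * (p - 1))) *
      (\<integral>\<^sup>+s. ennreal (indicator {0..t} s * (\<bar>g s\<bar> powr p * s powr (b * p - b))) \<partial>lborel)"
    (is "_ \<le> ?c * ?N")
proof -
  define I where "I = (\<integral>\<^sup>+s. ennreal (indicator {0..t} s * s powr - b * (\<bar>g s\<bar> * s powr b)) \<partial>lborel)"
  \<comment> \<open>On \<open>{0..t}\<close> the factors \<open>s powr - b\<close> and
    \<open>s powr b\<close> cancel except at \<open>s = 0\<close>, where both are 0.\<close>
  have nz: "AE s in lborel. s \<noteq> (0::real)" by (rule AE_lborel_singleton)
  have I_eq: "I = (\<integral>\<^sup>+s. ennreal \<bar>indicator {0..t} s * g s\<bar> \<partial>lborel)"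
    unfolding I_def
    by (rule nn_integral_cong_AE)
       (use nz in \<open>eventually_elim, auto simp: indicator_def powr_minus field_simps\<close>)
  have N_eq: "(\<integral>\<^sup>+s. ennreal (indicator {0..t} s * s powr - b * (\<bar>g s\<bar> * s powr b) powr p) \<partial>lborel) = ?N"
    by (rule nn_integral_cong_AE)
       (use nz in \<open>eventually_elim, auto simp: indicator_def powr_mult powr_powr powr_diff powr_minus field_simps\<close>)
  have "\<bar>hardy g t\<bar> \<le> (1 / t) * enn2real I"
    using t abs_integral_le_enn2real[of lborel "\<lambda>s. indicator {0..t} s * g s"]
    by (simp add: hardy_borel abs_mult set_lebesgue_integral_def I_eq divide_right_mono)
  then have "\<bar>hardy g t\<bar> powr p * t powr a \<le> ((1 / t) * enn2real I) powr p * t powr a"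
    using p by (intro mult_right_mono powr_mono2) auto
  also have "\<dots> = t powr (a - p) * enn2real I powr p"
    using t by (simp add: powr_mult powr_divide powr_diff)
  finally have "ennreal (\<bar>hardy g t\<bar> powr p * t powr a) \<le> ennreal (t powr (a - p)) * ennreal (enn2real I powr p)"
    by (simp add: ennreal_mult'[symmetric] ennreal_leI)
  \<comment> \<open>Jensen's inequality for \<open>\<bar>g s\<bar> * s powr b\<close>, where
    \<open>W\<close> is the total mass of the weight \<open>s powr - b\<close> on
    \<open>{0..t}\<close>.\<close>
  also have "\<dots> \<le> ennreal (t powr (a - p)) * (ennreal ((t powr (1 - b) / (1 - b)) powr (p - 1)) * ?N)"
    unfolding N_eq[symmetric] I_def using p b t
    by (intro mult_left_mono powr_nn_integral_le nn_integral_powr_from_0) auto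
  also have "\<dots> = ?c * ?N"
  proof -
    have "(1 - b) powr (1 - p) = 1 / (1 - b) powr (p - 1)"
      using powr_minus_divide[of "1 - b" "p - 1"] by simp
    then have "t powr (a - p) * (t powr (1 - b) / (1 - b)) powr (p - 1)
        = (1 - b) powr (1 - p) * (t powr (a - p) * t powr ((1 - b) * (p - 1)))"
      using b t by (simp add: powr_divide powr_powr)
    also have "\<dots> = (1 - b) powr (1 - p) * t powr (a - 1 - b * (p - 1))"
      by (simp add: powr_add[symmetric] algebra_simps)
    finally show ?thesis
      using b t by (simp add: mult.assoc[symmetric] ennreal_mult'[symmetric])
  qed
  finally show ?thesis .
qed

text \<open>Integrating the bound of \<open>hardy_powr_le\<close> in \<open>t\<close> and exchanging
  the order leaves the integral of \<open>t powr e\<close> over \<open>{s..}\<close>, finite because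
  \<open>e < - 1\<close>. The powers of \<open>s\<close> then combine to \<open>s powr a\<close>.
  The constant serves only to show that some bound exists.\<close>

lemma hardy_inequality:
  assumes p: "1 \<le> p" and a: "a < p - 1"
  obtains c :: real where "0 \<le> c"
    "\<And>g. g \<in> borel_measurable borel \<Longrightarrow> weighted_integral p a (hardy g) \<le> ennreal c * weighted_integral p a g"
proof -
  from ex_weight_exponent[OF p a] obtain b where b: "b < 1" "a < b * (p - 1)" .
  define e where "e = a - 1 - b * (p - 1)"
  have e: "e < - 1" using b by (simp add: e_def)
  define k where "k = (1 - b) powr (1 - p)"
  have k: "0 \<le> k" by (simp add: k_def)
  have "weighted_integral p a (hardy g) \<le> ennreal (k / - (e + 1)) * weighted_integral p a g"
    if [measurable]: "g \<in> borel_measurable borel" for g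
  proof -
    define G where "G = (\<lambda>s. ennreal (\<bar>g s\<bar> powr p * s powr (b * p - b)))"
    have [measurable]: "G \<in> borel_measurable borel" by (simp add: G_def)
    have [measurable]: "Measurable.pred (borel \<Otimes>\<^sub>M borel) (\<lambda>(t::real, s::real). s \<in> {0..t})"
      by (simp add: case_prod_beta)
    have "weighted_integral p a (hardy g)
        \<le> (\<integral>\<^sup>+t. \<integral>\<^sup>+s. ennreal (indicator {0<..} t * (k * t powr e)) * (indicator {0..t} s * G s) \<partial>lborel \<partial>lborel)"
      unfolding weighted_integral_lborel
    proof (rule nn_integral_mono)
      fix t :: real
      have "ennreal (\<bar>hardy g t\<bar> powr p * t powr a) * indicator {0<..} t
          \<le> ennreal (indicator {0<..} t * (k * t powr e)) *
            (\<integral>\<^sup>+s. ennreal (indicator {0..t} s * (\<bar>g s\<bar> powr p * s powr (b * p - b))) \<partial>lborel)"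
        using hardy_powr_le[of g p b t a] p b by (simp add: indicator_def k_def e_def)
      also have "\<dots> = (\<integral>\<^sup>+s. ennreal (indicator {0<..} t * (k * t powr e)) * (indicator {0..t} s * G s) \<partial>lborel)"
        by (subst nn_integral_cmult[symmetric])
           (auto simp: G_def indicator_def intro!: nn_integral_cong)
      finally show "ennreal (\<bar>hardy g t\<bar> powr p * t powr a) * indicator {0<..} t
        \<le> (\<integral>\<^sup>+s. ennreal (indicator {0<..} t * (k * t powr e)) * (indicator {0..t} s * G s) \<partial>lborel)" .
    qed
    also have "\<dots> = (\<integral>\<^sup>+s. \<integral>\<^sup>+t. ennreal (indicator {0<..} t * (k * t powr e)) * (indicator {0..t} s * G s) \<partial>lborel \<partial>lborel)"
      by (rule lborel_pair.Fubini'[symmetric]) measurable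
    also have "\<dots> = (\<integral>\<^sup>+s. ennreal (k / - (e + 1)) * (ennreal (\<bar>g s\<bar> powr p * s powr a) * indicator {0<..} s) \<partial>lborel)"
    proof (rule nn_integral_cong_AE)
      have "AE s in lborel. s \<noteq> (0::real)" by (rule AE_lborel_singleton)
      then show "AE s in lborel. (\<integral>\<^sup>+t. ennreal (indicator {0<..} t * (k * t powr e)) * (indicator {0..t} s * G s) \<partial>lborel)
          = ennreal (k / - (e + 1)) * (ennreal (\<bar>g s\<bar> powr p * s powr a) * indicator {0<..} s)"
      proof eventually_elim
        case (elim s)
        show ?case
        proof (cases "0 < s")
          case False
          then show ?thesis using elim by (simp add: indicator_def)
        next
          case True
          have "(\<integral>\<^sup>+t. ennreal (indicator {0<..} t * (k * t powr e)) * (indicator {0..t} s * G s) \<partial>lborel)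
              = (\<integral>\<^sup>+t. (ennreal k * G s) * ennreal (indicator {s..} t * t powr e) \<partial>lborel)"
            using True k by (intro nn_integral_cong) (auto simp: indicator_def ennreal_mult' mult_ac)
          also have "\<dots> = (ennreal k * G s) * ennreal (s powr (e + 1) / - (e + 1))"
            using nn_integral_powr_to_inf[OF e True] by (subst nn_integral_cmult) auto
          also have "\<dots> = ennreal (k * (\<bar>g s\<bar> powr p * s powr (b * p - b)) * (s powr (e + 1) / - (e + 1)))"
            using k e by (simp add: G_def ennreal_mult'[symmetric])
          also have "k * (\<bar>g s\<bar> powr p * s powr (b * p - b)) * (s powr (e + 1) / - (e + 1))
              = k / - (e + 1) * (\<bar>g s\<bar> powr p * (s powr (b * p - b) * s powr (e + 1)))"
            by (simp add: field_simps)
          also have "s powr (b * p - b) * s powr (e + 1) = s powr a"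
            by (simp add: powr_add[symmetric] e_def algebra_simps)
          finally show ?thesis
            using True k e by (simp add: ennreal_mult'[symmetric] ennreal_mult''[symmetric])
        qed
      qed
    qed
    also have "\<dots> = ennreal (k / - (e + 1)) * weighted_integral p a g"
      unfolding weighted_integral_lborel by (rule nn_integral_cmult) simp
    finally show ?thesis .
  qed
  moreover have "0 \<le> k / - (e + 1)" using k e by simp
  ultimately show ?thesis using that by blast
qed

text \<open>With \<open>x = \<bar>k s\<bar> * s powr b\<close>, the estimate
  \<open>x \<le> 1 + x powr p\<close> bounds \<open>\<bar>k s\<bar>\<close> by
  \<open>s powr - b\<close>, integrable at 0, plus \<open>s powr d\<close> times the weighted
  integrand, where \<open>d > 0\<close>. This makes a function of finite norm usable as a majorant
  for the averages.\<close>

lemma integrable_of_weighted_integral: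
  assumes p: "1 \<le> p" and a: "a < p - 1"
    and [measurable]: "k \<in> borel_measurable borel" and fin: "weighted_integral p a k < \<infinity>"
  shows "set_integrable lborel {0..t} k"
proof -
  from ex_weight_exponent[OF p a] obtain b where b: "b < 1" "a < b * (p - 1)" .
  \<comment> \<open>For negative \<open>t\<close> the interval is empty; \<open>T\<close> keeps the
    explicit integral of \<open>s powr - b\<close> applicable.\<close>
  define T where "T = max t 0"
  define d where "d = b * p - b - a"
  have d: "0 < d" using b by (simp add: d_def algebra_simps)
  have nz: "AE s in lborel. s \<noteq> (0::real)" by (rule AE_lborel_singleton)
  have "(\<integral>\<^sup>+s. ennreal (norm (indicator {0..t} s *\<^sub>R k s)) \<partial>lborel)
      \<le> (\<integral>\<^sup>+s. ennreal (indicator {0..T} s * s powr - b)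
             + ennreal (T powr d) * (ennreal (\<bar>k s\<bar> powr p * s powr a) * indicator {0<..} s) \<partial>lborel)"
  proof (rule nn_integral_mono_AE, use nz in eventually_elim)
    fix s :: real assume s: "s \<noteq> 0"
    show "ennreal (norm (indicator {0..t} s *\<^sub>R k s)) \<le> ennreal (indicator {0..T} s * s powr - b)
             + ennreal (T powr d) * (ennreal (\<bar>k s\<bar> powr p * s powr a) * indicator {0<..} s)"
    proof (cases "s \<in> {0..t}")
      case True
      define x where "x = \<bar>k s\<bar> * s powr b"
      have x: "0 \<le> x" by (simp add: x_def)
      have "x \<le> 1 + x powr p"
      proof (cases "x \<le> 1")
        case True
        then show ?thesis by (simp add: add_increasing2)
      next
        case False
        then have "x powr 1 \<le> x powr p" using p by (intro powr_mono) auto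
        then show ?thesis using False by simp
      qed
      then have "s powr - b * x \<le> s powr - b * (1 + x powr p)" by (intro mult_left_mono) auto
      also have "s powr - b * x = \<bar>k s\<bar>" using True s by (simp add: x_def powr_minus field_simps)
      also have "s powr - b * (1 + x powr p) = s powr - b + s powr d * (\<bar>k s\<bar> powr p * s powr a)"
      proof -
        have "s powr - b * x powr p = \<bar>k s\<bar> powr p * (s powr - b * s powr (b * p))"
          using True by (simp add: x_def powr_mult powr_powr)
        also have "s powr - b * s powr (b * p) = s powr d * s powr a"
          by (simp add: powr_add[symmetric] d_def)
        finally show ?thesis by (simp add: distrib_left mult_ac)
      qed
      also have "\<dots> \<le> s powr - b + T powr d * (\<bar>k s\<bar> powr p * s powr a)"
        using True d by (intro add_left_mono mult_right_mono powr_mono2) (auto simp: T_def)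
      finally show ?thesis
        using True s
        by (auto simp: T_def ennreal_mult'[symmetric] ennreal_plus[symmetric] simp del: ennreal_plus
            intro!: ennreal_leI)
    qed simp
  qed
  also have "\<dots> = ennreal (T powr (1 - b) / (1 - b)) + ennreal (T powr d) * weighted_integral p a k"
    unfolding weighted_integral_lborel using b
    by (subst nn_integral_add) (auto simp: nn_integral_cmult nn_integral_powr_from_0 T_def)
  also have "\<dots> < \<infinity>" using fin by (simp add: ennreal_mult_less_top)
  finally show ?thesis unfolding set_integrable_def by (auto simp: integrable_iff_bounded)
qed

section \<open>The best constant\<close>

lemma hardy_minus_id_boundI:
  assumes "\<And>g. g \<in> borel_measurable borel \<Longrightarrow> weighted_integral p a g < \<infinity> \<Longrightarrow>
    weighted_integral p a (\<lambda>t. hardy g t - g t) \<le> ennreal (K powr p) * weighted_integral p a g"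
  shows "hardy_minus_id_bound p a K"
  unfolding hardy_minus_id_bound_def
proof (intro allI impI)
  fix g assume g: "g \<in> borel_measurable (lebesgue_on {0..})" and fin: "weighted_integral p a g < \<infinity>"
  obtain g' where g': "g' \<in> borel_measurable borel"
    and ae: "AE t in lborel. 0 \<le> t \<longrightarrow> g t = g' t" and h: "\<And>t. hardy g t = hardy g' t"
    and "\<And>t. 0 < t \<Longrightarrow> hardy_adj g t = hardy_adj g' t"
    by (rule borel_representative[OF g]) (rule that)
  have "weighted_integral p a g = weighted_integral p a g'"
    by (rule weighted_integral_cong_AE) (use ae in \<open>eventually_elim, auto\<close>)
  moreover have "weighted_integral p a (\<lambda>t. hardy g t - g t) = weighted_integral p a (\<lambda>t. hardy g' t - g' t)"
    by (rule weighted_integral_cong_AE) (use ae in \<open>eventually_elim, auto simp: h\<close>)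
  ultimately show "weighted_integral p a (\<lambda>t. hardy g t - g t) \<le> ennreal (K powr p) * weighted_integral p a g"
    using assms[OF g'] fin by simp
qed

text \<open>Bounding \<open>\<bar>x - y\<bar> powr p\<close> by \<open>2 powr p\<close> times the
  sum of the two powers and applying Hardy's inequality to \<open>hardy g\<close> gives the factor
  \<open>2 powr p * (c + 1)\<close>, whose root of order \<open>p\<close> is
  \<open>K\<close>.\<close>

lemma ex_hardy_minus_id_bound:
  assumes p: "1 \<le> p" and a: "a < p - 1"
  obtains K where "0 \<le> K" "hardy_minus_id_bound p a K"
proof -
  from hardy_inequality[OF p a] obtain c where c: "0 \<le> c"
    "\<And>g. g \<in> borel_measurable borel \<Longrightarrow> weighted_integral p a (hardy g) \<le> ennreal c * weighted_integral p a g"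
    by blast
  define K where "K = (2 powr p * (c + 1)) powr (1 / p)"
  have K: "K powr p = 2 powr p * (c + 1)" using p c(1) by (simp add: K_def powr_powr)
  have "hardy_minus_id_bound p a K"
  proof (rule hardy_minus_id_boundI)
    fix g :: "real \<Rightarrow> real" assume [measurable]: "g \<in> borel_measurable borel"
    have *: "\<bar>x - y\<bar> powr p \<le> 2 powr p * (\<bar>x\<bar> powr p + \<bar>y\<bar> powr p)" for x y :: real
    proof -
      have "\<bar>x - y\<bar> powr p \<le> (2 * max \<bar>x\<bar> \<bar>y\<bar>) powr p" using p by (intro powr_mono2) auto
      also have "\<dots> = 2 powr p * max \<bar>x\<bar> \<bar>y\<bar> powr p" by (simp add: powr_mult)
      also have "max \<bar>x\<bar> \<bar>y\<bar> powr p \<le> \<bar>x\<bar> powr p + \<bar>y\<bar> powr p" by (simp add: max_def)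
      finally show ?thesis by simp
    qed
    have "weighted_integral p a (\<lambda>t. hardy g t - g t)
        \<le> (\<integral>\<^sup>+t. ennreal (2 powr p) * (ennreal (\<bar>hardy g t\<bar> powr p * t powr a) * indicator {0<..} t
             + ennreal (\<bar>g t\<bar> powr p * t powr a) * indicator {0<..} t) \<partial>lborel)"
      unfolding weighted_integral_lborel
    proof (rule nn_integral_mono)
      fix t :: real
      have "\<bar>hardy g t - g t\<bar> powr p * t powr a \<le> 2 powr p * (\<bar>hardy g t\<bar> powr p * t powr a + \<bar>g t\<bar> powr p * t powr a)"
        using mult_right_mono[OF *[of "hardy g t" "g t"], of "t powr a"] by (simp add: algebra_simps)
      then have "ennreal (\<bar>hardy g t - g t\<bar> powr p * t powr a)
          \<le> ennreal (2 powr p) * (ennreal (\<bar>hardy g t\<bar> powr p * t powr a) + ennreal (\<bar>g t\<bar> powr p * t powr a))"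
        by (simp add: ennreal_mult'[symmetric] ennreal_plus[symmetric] ennreal_leI del: ennreal_plus)
      then show "ennreal (\<bar>hardy g t - g t\<bar> powr p * t powr a) * indicator {0<..} t
          \<le> ennreal (2 powr p) * (ennreal (\<bar>hardy g t\<bar> powr p * t powr a) * indicator {0<..} t
             + ennreal (\<bar>g t\<bar> powr p * t powr a) * indicator {0<..} t)"
        by (simp add: indicator_def)
    qed
    also have "\<dots> = ennreal (2 powr p) * (weighted_integral p a (hardy g) + weighted_integral p a g)"
      unfolding weighted_integral_lborel by (subst nn_integral_cmult) (auto simp: nn_integral_add)
    also have "\<dots> \<le> ennreal (2 powr p) * (ennreal c * weighted_integral p a g + weighted_integral p a g)"
      by (intro mult_left_mono add_right_mono c(2)) auto
    also have "\<dots> = ennreal (K powr p) * weighted_integral p a g"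
    proof -
      have "ennreal (K powr p) = ennreal (2 powr p) * (ennreal c + 1)"
        using c(1) by (simp add: K ennreal_mult')
      then show ?thesis by (simp add: distrib_right mult.assoc)
    qed
    finally show "weighted_integral p a (\<lambda>t. hardy g t - g t) \<le> ennreal (K powr p) * weighted_integral p a g" .
  qed
  then show ?thesis using that[of K] by (simp add: K_def)
qed

text \<open>\<open>LEAST\<close> is meaningful once the infimum \<open>C\<close> of the bounds is
  itself a bound. Each \<open>C + inverse (real (Suc n))\<close> exceeds some bound and hence is
  one; the limit passes through the product because the norm of \<open>g\<close> is finite.\<close>

lemma C_const_least:
  assumes p: "1 \<le> p" and a: "a < p - 1"
  shows "0 \<le> C_const p a" "hardy_minus_id_bound p a (C_const p a)"
    "\<And>K. 0 \<le> K \<Longrightarrow> hardy_minus_id_bound p a K \<Longrightarrow> C_const p a \<le> K"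
proof -
  define S where "S = {K. 0 \<le> K \<and> hardy_minus_id_bound p a K}"
  have ne: "S \<noteq> {}" using ex_hardy_minus_id_bound[OF p a] unfolding S_def by blast
  have bdd: "bdd_below S" by (auto simp: S_def)
  define C where "C = Inf S"
  have C0: "0 \<le> C" unfolding C_def by (rule cInf_greatest[OF ne]) (auto simp: S_def)
  have "hardy_minus_id_bound p a C"
    unfolding hardy_minus_id_bound_def
  proof (intro allI impI)
    fix g assume g: "g \<in> borel_measurable (lebesgue_on {0..})" "weighted_integral p a g < \<infinity>"
    have "weighted_integral p a (\<lambda>t. hardy g t - g t)
        \<le> ennreal ((C + inverse (real (Suc n))) powr p) * weighted_integral p a g" for n
    proof -
      have "\<exists>K\<in>S. K < C + inverse (real (Suc n))"
        using cInf_lessD[OF ne, of "C + inverse (real (Suc n))"] unfolding C_def by auto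
      then obtain K where K: "K \<in> S" "K < C + inverse (real (Suc n))" ..
      then have "weighted_integral p a (\<lambda>t. hardy g t - g t) \<le> ennreal (K powr p) * weighted_integral p a g"
        using g by (auto simp: S_def hardy_minus_id_bound_def)
      also have "\<dots> \<le> ennreal ((C + inverse (real (Suc n))) powr p) * weighted_integral p a g"
        using K p by (intro mult_right_mono ennreal_leI powr_mono2) (auto simp: S_def)
      finally show ?thesis .
    qed
    moreover have "(\<lambda>n. ennreal ((C + inverse (real (Suc n))) powr p) * weighted_integral p a g)
        \<longlonglongrightarrow> ennreal ((C + 0) powr p) * weighted_integral p a g"
    proof (rule tendsto_mult_ennreal)
      have "(\<lambda>n. C + inverse (real (Suc n))) \<longlonglongrightarrow> C + 0"
        by (intro tendsto_add tendsto_const LIMSEQ_inverse_real_of_nat)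
      then show "(\<lambda>n. ennreal ((C + inverse (real (Suc n))) powr p)) \<longlonglongrightarrow> ennreal ((C + 0) powr p)"
        using p C0 by (intro tendsto_ennrealI tendsto_powr' tendsto_const) (auto intro!: always_eventually)
    qed (use g(2) in auto)
    ultimately show "weighted_integral p a (\<lambda>t. hardy g t - g t) \<le> ennreal (C powr p) * weighted_integral p a g"
      by (auto intro: LIMSEQ_le_const)
  qed
  then have least: "0 \<le> C \<and> hardy_minus_id_bound p a C" using C0 by simp
  have min: "C \<le> K" if "0 \<le> K \<and> hardy_minus_id_bound p a K" for K
    unfolding C_def by (rule cInf_lower[OF _ bdd]) (use that in \<open>simp add: S_def\<close>)
  have eq: "C_const p a = C"
    unfolding C_const_def by (rule Least_equality) (use least min in auto)
  show "0 \<le> C_const p a" "hardy_minus_id_bound p a (C_const p a)"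
    "\<And>K. 0 \<le> K \<Longrightarrow> hardy_minus_id_bound p a K \<Longrightarrow> C_const p a \<le> K"
    using least min by (auto simp: eq)
qed

section \<open>Functions supported away from 0, and positivity of the best constant\<close>

lemma weighted_integral_bounded_support:
  assumes p: "1 \<le> p" and c: "0 < c" and M: "0 \<le> M"
    and u: "\<And>t. 0 < t \<Longrightarrow> \<bar>u t\<bar> \<le> M * indicator {c..d} t"
  shows "weighted_integral p a u < \<infinity>"
proof -
  have "weighted_integral p a u \<le> (\<integral>\<^sup>+t. ennreal (M powr p * (c powr a + d powr a)) * indicator {c..d} t \<partial>lborel)"
    unfolding weighted_integral_lborel
  proof (rule nn_integral_mono)
    fix t :: real
    show "ennreal (\<bar>u t\<bar> powr p * t powr a) * indicator {0<..} t
        \<le> ennreal (M powr p * (c powr a + d powr a)) * indicator {c..d} t"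
    proof (cases "t \<in> {c..d}")
      case True
      \<comment> \<open>Whether \<open>t powr a\<close> is largest at \<open>d\<close> or at
        \<open>c\<close> depends on the sign of \<open>a\<close>; the sum covers both.\<close>
      have "t powr a \<le> c powr a + d powr a"
      proof (cases "0 \<le> a")
        case pos: True
        then have "t powr a \<le> d powr a" using True c by (intro powr_mono2) auto
        then show ?thesis by (simp add: add_increasing)
      next
        case False
        then have "t powr a \<le> c powr a" using True c by (intro powr_mono2') auto
        then show ?thesis by (simp add: add_increasing2)
      qed
      moreover have "\<bar>u t\<bar> powr p \<le> M powr p" using u[of t] True c p by (intro powr_mono2) auto
      ultimately show ?thesis using True c by (auto intro!: ennreal_leI mult_mono)
    next
      case False
      then show ?thesis using u[of t] by (auto simp: indicator_def)
    qed
  qed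
  also have "\<dots> = ennreal (M powr p * (c powr a + d powr a)) * emeasure lborel {c..d}"
    by (rule nn_integral_cmult_indicator) simp
  also have "\<dots> < \<infinity>" by (simp add: ennreal_mult_less_top emeasure_lborel_Icc_eq)
  finally show ?thesis .
qed

text \<open>Positivity matters for functions of infinite norm, because
  \<open>0 * \<infinity> = 0\<close> in \<open>ennreal\<close>. A zero constant would force
  \<open>hardy g = g\<close> a.e. on the positive axis for every \<open>g\<close> of finite norm;
  but the indicator of \<open>{1..2}\<close> vanishes on \<open>{3..4}\<close>, where its average is
  \<open>1 / t\<close>.\<close>

lemma C_const_pos:
  assumes p: "1 \<le> p" and a: "a < p - 1"
  shows "0 < C_const p a"
proof (rule ccontr)
  assume "\<not> 0 < C_const p a"
  then have C: "C_const p a = 0" using C_const_least(1)[OF p a] by simp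
  define g where "g = indicat_real {1..2::real}"
  have [measurable]: "g \<in> borel_measurable borel" by (simp add: g_def)
  have "weighted_integral p a g < \<infinity>"
    by (rule weighted_integral_bounded_support[of p 1 1 g 2]) (use p in \<open>auto simp: g_def\<close>)
  moreover have "g \<in> borel_measurable (lebesgue_on {0..})"
    by (intro measurable_restrict_space1 measurable_completion) simp
  ultimately have "weighted_integral p a (\<lambda>t. hardy g t - g t) \<le> ennreal (0 powr p) * weighted_integral p a g"
    using C_const_least(2)[OF p a] unfolding hardy_minus_id_bound_def C by blast
  then have "weighted_integral p a (\<lambda>t. hardy g t - g t) = 0" by simp
  then have "AE t in lborel. ennreal (\<bar>hardy g t - g t\<bar> powr p * t powr a) * indicator {0<..} t = 0"
    unfolding weighted_integral_lborel by (subst (asm) nn_integral_0_iff_AE) auto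
  then have "AE t in lborel. t \<notin> {3..4::real}"
  proof eventually_elim
    case (elim t)
    show ?case
    proof
      assume t: "t \<in> {3..4}"
      have "(\<lambda>s. indicator {0..t} s *\<^sub>R g s) = indicat_real {1..2}"
        using t by (auto simp: g_def indicator_def fun_eq_iff)
      then have "hardy g t = 1 / t" by (simp add: hardy_borel set_lebesgue_integral_def)
      moreover have "g t = 0" using t by (simp add: g_def)
      ultimately show False using elim t by (simp add: ennreal_eq_0_iff mult_le_0_iff not_le)
    qed
  qed
  then have "emeasure lborel {3..4::real} = 0"
    by (subst (asm) AE_iff_measurable[of "{3..4}"]) auto
  then show False by simp
qed

section \<open>The two operators on admissible functions\<close>

text \<open>In \<open>t * hardy (hardy_adj f) t\<close> the function \<open>f u / u\<close> is
  integrated over \<open>0 \<le> s \<le> t\<close> and \<open>s \<le> u\<close>. Integrating in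
  \<open>s\<close> first multiplies it by the length \<open>min u t\<close>, which gives
  \<open>f u\<close> below \<open>t\<close> and \<open>t * (f u / u)\<close> above
  \<open>t\<close>.\<close>

lemma hardy_eq_minus_id_hardy_adj:
  assumes [measurable]: "f \<in> borel_measurable borel"
    and f0: "set_integrable lborel {0..1} f" and f1: "set_integrable lborel {1..} (\<lambda>s. f s / s)"
    and t: "0 < t"
  shows "hardy f t = hardy (hardy_adj f) t - hardy_adj f t"
proof -
  \<comment> \<open>The cut point 1 is moved to \<open>t\<close>: between the two,
    \<open>f u\<close> and \<open>f u / u\<close> differ by a bounded factor.\<close>
  have i0: "set_integrable lborel {0..t} f"
    unfolding set_integrable_def
  proof (rule Bochner_Integration.integrable_bound)
    show "integrable lborel (\<lambda>u. \<bar>indicator {0..1} u *\<^sub>R f u\<bar> + t * \<bar>indicator {1..} u *\<^sub>R (f u / u)\<bar>)"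
      using f0 f1 unfolding set_integrable_def by (intro Bochner_Integration.integrable_add Bochner_Integration.integrable_mult_right Bochner_Integration.integrable_abs)
    show "AE u in lborel. norm (indicator {0..t} u *\<^sub>R f u)
        \<le> norm (\<bar>indicator {0..1} u *\<^sub>R f u\<bar> + t * \<bar>indicator {1..} u *\<^sub>R (f u / u)\<bar>)"
    proof (rule AE_I2)
      fix u :: real
      have "\<bar>f u\<bar> \<le> t * (\<bar>f u\<bar> / u)" if "1 < u" "u \<le> t"
      proof -
        have "\<bar>f u\<bar> * u \<le> \<bar>f u\<bar> * t" using that by (intro mult_left_mono) auto
        then show ?thesis using that by (simp add: field_simps)
      qed
      then show "norm (indicator {0..t} u *\<^sub>R f u)
        \<le> norm (\<bar>indicator {0..1} u *\<^sub>R f u\<bar> + t * \<bar>indicator {1..} u *\<^sub>R (f u / u)\<bar>)"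
        using t by (auto simp: indicator_def abs_divide)
    qed
  qed simp
  have i1: "set_integrable lborel {t..} (\<lambda>u. f u / u)"
    unfolding set_integrable_def
  proof (rule Bochner_Integration.integrable_bound)
    show "integrable lborel (\<lambda>u. (1 / t) * \<bar>indicator {0..1} u *\<^sub>R f u\<bar> + \<bar>indicator {1..} u *\<^sub>R (f u / u)\<bar>)"
      using f0 f1 unfolding set_integrable_def by (intro Bochner_Integration.integrable_add Bochner_Integration.integrable_mult_right Bochner_Integration.integrable_abs)
    show "AE u in lborel. norm (indicator {t..} u *\<^sub>R (f u / u))
        \<le> norm ((1 / t) * \<bar>indicator {0..1} u *\<^sub>R f u\<bar> + \<bar>indicator {1..} u *\<^sub>R (f u / u)\<bar>)"
    proof (rule AE_I2)
      fix u :: real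
      have "\<bar>f u\<bar> / u \<le> \<bar>f u\<bar> / t" if "t \<le> u"
        using that t by (intro divide_left_mono) auto
      then show "norm (indicator {t..} u *\<^sub>R (f u / u))
        \<le> norm ((1 / t) * \<bar>indicator {0..1} u *\<^sub>R f u\<bar> + \<bar>indicator {1..} u *\<^sub>R (f u / u)\<bar>)"
        using t by (auto simp: indicator_def abs_divide)
    qed
  qed simp
  define G where "G = (\<lambda>u. indicator {0..t} u *\<^sub>R f u + t * (indicator {t..} u *\<^sub>R (f u / u)))"
  define F where "F = (\<lambda>s u. indicator {0..t} s * (indicator {s..} u * (f u / u)))"
  have [measurable]: "Measurable.pred (borel \<Otimes>\<^sub>M borel) (\<lambda>x::real \<times> real. snd x \<in> {fst x..})"
    by simp
  have Fm [measurable]: "case_prod F \<in> borel_measurable (lborel \<Otimes>\<^sub>M lborel)"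
    unfolding F_def case_prod_beta by measurable
  \<comment> \<open>At \<open>u = 0\<close> the quotient \<open>f u / u\<close> is 0 and loses
    \<open>f u\<close>; at \<open>u = t\<close> both terms of \<open>G\<close> count.\<close>
  have ne: "AE u in lborel. u \<noteq> 0 \<and> u \<noteq> t"
    using AE_lborel_singleton[of "0::real"] AE_lborel_singleton[of t] by eventually_elim auto
  have ind: "indicator {0..t} s * indicator {s..} u = indicat_real {0..min u t} s" for s u
    by (auto simp: indicator_def)
  have F_alt: "F s u = (f u / u) * indicator {0..min u t} s" for s u
    unfolding ind[symmetric] F_def by (simp add: mult_ac)
  \<comment> \<open>Tonelli for the absolute values, with \<open>s\<close> as inner variable, gives
    the joint integrability that Fubini requires for the signed integral.\<close>
  have "(\<integral>\<^sup>+z. ennreal (norm (case_prod F z)) \<partial>(lborel \<Otimes>\<^sub>M lborel))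
      = (\<integral>\<^sup>+u. \<integral>\<^sup>+s. ennreal (norm (F s u)) \<partial>lborel \<partial>lborel)"
    by (subst lborel_pair.nn_integral_snd[symmetric]) auto
  also have "\<dots> = (\<integral>\<^sup>+u. ennreal (norm (G u)) \<partial>lborel)"
  proof (rule nn_integral_cong_AE, use ne in eventually_elim)
    fix u :: real assume u: "u \<noteq> 0 \<and> u \<noteq> t"
    have "(\<integral>\<^sup>+s. ennreal (norm (F s u)) \<partial>lborel) = (\<integral>\<^sup>+s. ennreal \<bar>f u / u\<bar> * indicator {0..min u t} s \<partial>lborel)"
      by (intro nn_integral_cong) (auto simp: F_alt indicator_def)
    also have "\<dots> = ennreal \<bar>f u / u\<bar> * emeasure lborel {0..min u t}"
      by (rule nn_integral_cmult_indicator) simp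
    also have "\<dots> = ennreal (norm (G u))"
      using u t by (auto simp: G_def emeasure_lborel_Icc_eq indicator_def min_def abs_mult ennreal_mult'[symmetric] mult_ac)
    finally show "(\<integral>\<^sup>+s. ennreal (norm (F s u)) \<partial>lborel) = ennreal (norm (G u))" .
  qed
  also have "\<dots> < \<infinity>"
  proof -
    have "integrable lborel G"
      using i0 i1 unfolding set_integrable_def G_def by (intro Bochner_Integration.integrable_add Bochner_Integration.integrable_mult_right)
    then show ?thesis by (simp add: integrable_iff_bounded)
  qed
  finally have Fi: "integrable (lborel \<Otimes>\<^sub>M lborel) (case_prod F)"
    by (intro integrableI_bounded) auto
  have "t * hardy (hardy_adj f) t = (LINT s|lborel. LINT u|lborel. F s u)"
    using right_inverse[of t] t unfolding hardy_borel[OF borel_measurable_hardy_adj[OF assms(1)]] set_lebesgue_integral_def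
    by (simp add: hardy_adj_borel set_lebesgue_integral_def F_def inverse_eq_divide
        del: times_divide_eq_right times_divide_eq_left)
  also have "\<dots> = (LINT u|lborel. LINT s|lborel. F s u)"
    by (rule lborel_pair.Fubini_integral[OF Fi, symmetric])
  also have "\<dots> = (LINT u|lborel. G u)"
  proof (rule integral_cong_AE)
    show "AE u in lborel. (LINT s|lborel. F s u) = G u"
    proof (use ne in eventually_elim)
      fix u :: real assume u: "u \<noteq> 0 \<and> u \<noteq> t"
      have "(LINT s|lborel. F s u) = (f u / u) * measure lborel {0..min u t}"
        unfolding F_alt by simp
      also have "\<dots> = G u" using u t by (auto simp: G_def indicator_def min_def)
      finally show "(LINT s|lborel. F s u) = G u" .
    qed
    have "case_prod (\<lambda>u s. F s u) \<in> borel_measurable (borel \<Otimes>\<^sub>M lborel)"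
      using measurable_pair_swap[OF Fm] by (simp add: case_prod_beta cong: measurable_cong_sets)
    then show "(\<lambda>u. LINT s|lborel. F s u) \<in> borel_measurable lborel"
      by (simp add: lborel.borel_measurable_lebesgue_integral)
    show "G \<in> borel_measurable lborel" unfolding G_def by measurable
  qed
  also have "\<dots> = t * hardy f t + t * hardy_adj f t"
    using right_inverse[of t] i0 i1 t unfolding G_def set_integrable_def
    by (subst Bochner_Integration.integral_add)
       (simp_all add: hardy_borel hardy_adj_borel set_lebesgue_integral_def inverse_eq_divide
          del: times_divide_eq_right times_divide_eq_left)
  finally show ?thesis using t by (simp add: distrib_left[symmetric])
qed

text \<open>The two finiteness conditions at 1 are the integrability hypotheses of
  \<open>hardy_eq_minus_id_hardy_adj\<close> for a Borel version of \<open>f\<close>; the adjoint of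
  that version serves as \<open>g\<close>.\<close>

lemma admissible_hardy_adj:
  assumes "admissible f"
  obtains g where "g \<in> borel_measurable borel" "\<And>t. 0 < t \<Longrightarrow> hardy_adj f t = g t"
    "\<And>t. 0 < t \<Longrightarrow> hardy f t = hardy g t - g t"
proof -
  from assms have f: "f \<in> borel_measurable (lebesgue_on {0..})"
    and fin0: "(\<integral>\<^sup>+ s\<in>{0..1}. ennreal \<bar>f s\<bar> \<partial>lborel) < \<infinity>"
    and fin1: "(\<integral>\<^sup>+ s\<in>{1..}. (ennreal \<bar>f s\<bar> / ennreal s) \<partial>lborel) < \<infinity>"
    unfolding admissible_def nn_hardy_def nn_hardy_adj_def by (auto simp: nn_integral_completion)
  obtain f' where f' [measurable]: "f' \<in> borel_measurable borel"
    and ae: "AE t in lborel. 0 \<le> t \<longrightarrow> f t = f' t" and h: "\<And>t. hardy f t = hardy f' t"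
    and ha: "\<And>t. 0 < t \<Longrightarrow> hardy_adj f t = hardy_adj f' t"
    by (rule borel_representative[OF f]) (rule that)
  have "(\<integral>\<^sup>+s. ennreal (norm (indicator {0..1} s *\<^sub>R f' s)) \<partial>lborel) = (\<integral>\<^sup>+ s\<in>{0..1}. ennreal \<bar>f s\<bar> \<partial>lborel)"
    by (rule nn_integral_cong_AE) (use ae in \<open>eventually_elim, auto simp: indicator_def\<close>)
  then have f0: "set_integrable lborel {0..1} f'"
    using fin0 unfolding set_integrable_def by (auto simp: integrable_iff_bounded)
  have "(\<integral>\<^sup>+s. ennreal (norm (indicator {1..} s *\<^sub>R (f' s / s))) \<partial>lborel)
      = (\<integral>\<^sup>+ s\<in>{1..}. (ennreal \<bar>f s\<bar> / ennreal s) \<partial>lborel)"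
    by (rule nn_integral_cong_AE)
       (use ae in \<open>eventually_elim, auto simp: indicator_def divide_ennreal abs_divide\<close>)
  then have f1: "set_integrable lborel {1..} (\<lambda>s. f' s / s)"
    using fin1 unfolding set_integrable_def by (auto simp: integrable_iff_bounded)
  show ?thesis
    by (rule that[of "hardy_adj f'"])
       (use h ha hardy_eq_minus_id_hardy_adj[OF f' f0 f1] in auto)
qed

section \<open>Approximation by images of admissible functions\<close>

text \<open>The norms on the right converge by dominated convergence. The majorant is also
  integrable on \<open>{0..t}\<close>, so \<open>hardy (u n) t\<close> converges for each
  \<open>t\<close>, and Fatou's lemma handles the left side.\<close>

lemma hardy_minus_id_limit:
  assumes p: "1 \<le> p" and a: "a < p - 1" and B: "B < \<infinity>"
    and [measurable]: "\<And>n. u n \<in> borel_measurable borel" "g \<in> borel_measurable borel" "k \<in> borel_measurable borel"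
    and fin: "weighted_integral p a k < \<infinity>"
    and conv: "AE t in lborel. 0 < t \<longrightarrow> (\<lambda>n. u n t) \<longlonglongrightarrow> g t"
    and bound: "\<And>n t. 0 < t \<Longrightarrow> \<bar>u n t\<bar> \<le> k t"
    and u: "\<And>n. weighted_integral p a (\<lambda>t. hardy (u n) t - u n t) \<le> B * weighted_integral p a (u n)"
  shows "weighted_integral p a (\<lambda>t. hardy g t - g t) \<le> B * weighted_integral p a g"
proof -
  have powr_lim: "(\<lambda>n. ennreal (\<bar>v n\<bar> powr p * t powr a) * indicator {0<..} t)
      \<longlonglongrightarrow> ennreal (\<bar>w\<bar> powr p * t powr a) * indicator {0<..} t"
    if "0 < t \<longrightarrow> v \<longlonglongrightarrow> w" for v w and t :: real
  proof (cases "0 < t")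
    case True
    then have "(\<lambda>n. \<bar>v n\<bar> powr p) \<longlonglongrightarrow> \<bar>w\<bar> powr p"
      using that p by (intro tendsto_powr' tendsto_rabs tendsto_const) auto
    then have "(\<lambda>n. ennreal (\<bar>v n\<bar> powr p * t powr a)) \<longlonglongrightarrow> ennreal (\<bar>w\<bar> powr p * t powr a)"
      by (intro tendsto_ennrealI tendsto_mult tendsto_const)
    then show ?thesis using True by simp
  qed simp
  have norm_lim: "(\<lambda>n. weighted_integral p a (u n)) \<longlonglongrightarrow> weighted_integral p a g"
    unfolding weighted_integral_lborel
  proof (rule nn_integral_dominated_convergence[where w = "\<lambda>t. ennreal (\<bar>k t\<bar> powr p * t powr a) * indicator {0<..} t"])
    show "AE t in lborel. ennreal (\<bar>u n t\<bar> powr p * t powr a) * indicator {0<..} t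
        \<le> ennreal (\<bar>k t\<bar> powr p * t powr a) * indicator {0<..} t" for n
    proof (rule AE_I2)
      fix t :: real
      show "ennreal (\<bar>u n t\<bar> powr p * t powr a) * indicator {0<..} t
        \<le> ennreal (\<bar>k t\<bar> powr p * t powr a) * indicator {0<..} t"
        using p bound[of t n] by (auto simp: indicator_def intro!: ennreal_leI mult_right_mono powr_mono2)
    qed
    show "(\<integral>\<^sup>+t. ennreal (\<bar>k t\<bar> powr p * t powr a) * indicator {0<..} t \<partial>lborel) < \<infinity>"
      using fin by (simp add: weighted_integral_lborel)
    show "AE t in lborel. (\<lambda>n. ennreal (\<bar>u n t\<bar> powr p * t powr a) * indicator {0<..} t)
        \<longlonglongrightarrow> ennreal (\<bar>g t\<bar> powr p * t powr a) * indicator {0<..} t"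
      using conv by eventually_elim (rule powr_lim)
  qed simp_all
  \<comment> \<open>With both \<open>B\<close> and the limit norm finite, the product with
    \<open>B\<close> is continuous in \<open>ennreal\<close>.\<close>
  have "weighted_integral p a (u n) \<le> weighted_integral p a k" for n
    by (rule weighted_integral_mono[OF p]) (use bound in \<open>force intro: order_trans\<close>)
  then have "weighted_integral p a g \<le> weighted_integral p a k"
    by (intro LIMSEQ_le_const2[OF norm_lim]) auto
  then have g_fin: "weighted_integral p a g < \<infinity>" using fin by (rule le_less_trans)
  have hardy_lim: "(\<lambda>n. hardy (u n) t) \<longlonglongrightarrow> hardy g t" for t
    unfolding hardy_borel[OF assms(4)] hardy_borel[OF assms(5)] set_lebesgue_integral_def
  proof (intro tendsto_mult tendsto_const integral_dominated_convergence[where w = "\<lambda>s. indicator {0..t} s *\<^sub>R k s"])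
    show "integrable lborel (\<lambda>s. indicator {0..t} s *\<^sub>R k s)"
      using integrable_of_weighted_integral[OF p a _ fin] by (simp add: set_integrable_def)
    have ne: "AE s in lborel. s \<noteq> (0::real)" by (rule AE_lborel_singleton)
    show "AE s in lborel. norm (indicator {0..t} s *\<^sub>R u n s) \<le> indicator {0..t} s *\<^sub>R k s" for n
      using ne by eventually_elim (use bound in \<open>auto simp: indicator_def\<close>)
    show "AE s in lborel. (\<lambda>n. indicator {0..t} s *\<^sub>R u n s) \<longlonglongrightarrow> indicator {0..t} s *\<^sub>R g s"
      using ne conv by eventually_elim (auto simp: indicator_def)
  qed simp_all
  have "weighted_integral p a (\<lambda>t. hardy g t - g t)
      = (\<integral>\<^sup>+t. liminf (\<lambda>n. ennreal (\<bar>hardy (u n) t - u n t\<bar> powr p * t powr a) * indicator {0<..} t) \<partial>lborel)"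
    unfolding weighted_integral_lborel
  proof (rule nn_integral_cong_AE, use conv in eventually_elim)
    fix t :: real assume "0 < t \<longrightarrow> (\<lambda>n. u n t) \<longlonglongrightarrow> g t"
    then have "(\<lambda>n. ennreal (\<bar>hardy (u n) t - u n t\<bar> powr p * t powr a) * indicator {0<..} t)
        \<longlonglongrightarrow> ennreal (\<bar>hardy g t - g t\<bar> powr p * t powr a) * indicator {0<..} t"
      by (intro powr_lim impI tendsto_diff hardy_lim) auto
    then show "ennreal (\<bar>hardy g t - g t\<bar> powr p * t powr a) * indicator {0<..} t
        = liminf (\<lambda>n. ennreal (\<bar>hardy (u n) t - u n t\<bar> powr p * t powr a) * indicator {0<..} t)"
      by (rule lim_imp_Liminf[OF sequentially_bot, symmetric])
  qed
  also have "\<dots> \<le> liminf (\<lambda>n. weighted_integral p a (\<lambda>t. hardy (u n) t - u n t))"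
    unfolding weighted_integral_lborel by (rule nn_integral_liminf) simp
  also have "\<dots> \<le> liminf (\<lambda>n. B * weighted_integral p a (u n))"
    by (intro Liminf_mono always_eventually allI u)
  also have "\<dots> = B * weighted_integral p a g"
    using norm_lim B g_fin
    by (intro lim_imp_Liminf tendsto_mult_ennreal tendsto_const) (auto simp: less_top)
  finally show ?thesis .
qed

text \<open>The factor \<open>s\<close> in the bound makes \<open>f s / s\<close> bounded with
  bounded support, and it is at most 1 on \<open>{0..1}\<close>.\<close>

lemma admissibleI_bounded_support:
  assumes [measurable]: "f \<in> borel_measurable borel"
    and c: "0 < c" and M: "0 \<le> M" and f: "\<And>s. 0 \<le> s \<Longrightarrow> \<bar>f s\<bar> \<le> M * s * indicator {c..d} s"
  shows "admissible f"
proof -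
  have "f \<in> borel_measurable (lebesgue_on {0..})"
    by (intro measurable_restrict_space1 measurable_completion) simp
  moreover have "(\<integral>\<^sup>+ s\<in>{0..1}. ennreal \<bar>f s\<bar> \<partial>lborel) \<le> (\<integral>\<^sup>+ s. ennreal M * indicator {0..1::real} s \<partial>lborel)"
  proof (rule nn_integral_mono)
    fix s :: real
    have "\<bar>f s\<bar> \<le> M" if "0 \<le> s" "s \<le> 1"
    proof -
      have "M * s * indicator {c..d} s \<le> M * 1 * 1"
        using that M by (intro mult_mono) (auto simp: indicator_def)
      then show ?thesis using f[of s] that by simp
    qed
    then show "ennreal \<bar>f s\<bar> * indicator {0..1} s \<le> ennreal M * indicator {0..1} s"
      by (auto simp: indicator_def intro!: ennreal_leI)
  qed
  moreover have "\<dots> < \<infinity>" by (subst nn_integral_cmult_indicator) (simp_all add: ennreal_mult_less_top)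
  moreover have "(\<integral>\<^sup>+ s\<in>{1..}. (ennreal \<bar>f s\<bar> / ennreal s) \<partial>lborel) \<le> (\<integral>\<^sup>+ s. ennreal M * indicator {c..d} s \<partial>lborel)"
  proof (rule nn_integral_mono)
    fix s :: real
    have "ennreal \<bar>f s\<bar> / ennreal s \<le> ennreal M * indicator {c..d} s" if "1 \<le> s"
    proof -
      have "\<bar>f s\<bar> / s \<le> M * indicator {c..d} s"
        using f[of s] that by (simp add: pos_divide_le_eq mult_ac)
      then show ?thesis using that f[of s]
        by (cases "s \<in> {c..d}") (auto simp: divide_ennreal intro: ennreal_leI)
    qed
    then show "ennreal \<bar>f s\<bar> / ennreal s * indicator {1..} s \<le> ennreal M * indicator {c..d} s"
      by (cases "1 \<le> s") auto
  qed
  moreover have "\<dots> < \<infinity>"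
    by (subst nn_integral_cmult_indicator) (simp_all add: ennreal_mult_less_top emeasure_lborel_Icc_eq)
  ultimately show ?thesis
    unfolding admissible_def nn_hardy_def nn_hardy_adj_def by (auto simp: nn_integral_completion intro: le_less_trans)
qed

text \<open>\<open>f s / s\<close> is a difference quotient up to sign, so its integral over
  \<open>{t..}\<close> is \<open>1 / h\<close> times the difference of the tails of
  \<open>\<phi>\<close> from \<open>t\<close> and from \<open>t + h\<close>. The condition
  \<open>h \<le> c / 2\<close> keeps the supports away from 0.\<close>

lemma moving_average_hardy_adj:
  fixes \<phi> :: "real \<Rightarrow> real"
  assumes cont: "continuous_on UNIV \<phi>" and c: "0 < c" and M: "0 \<le> M"
    and bound: "\<And>s. \<bar>\<phi> s\<bar> \<le> M * indicator {c..d} s"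
    and h: "0 < h" "h \<le> c / 2"
  defines "f \<equiv> \<lambda>s. s / h * (\<phi> s - \<phi> (s + h))"
  shows "admissible f"
    and "\<And>t. 0 < t \<Longrightarrow> hardy_adj f t = (1 / h) * integral {t..t + h} \<phi>"
    and "\<And>t. 0 < t \<Longrightarrow> \<bar>hardy_adj f t\<bar> \<le> M * indicator {c / 2..d} t"
proof -
  have [measurable]: "\<phi> \<in> borel_measurable borel"
    using cont by (rule borel_measurable_continuous_onI)
  have [measurable]: "f \<in> borel_measurable borel" unfolding f_def by measurable
  \<comment> \<open>If \<open>\<phi> r\<close> is nonzero, then \<open>c \<le> r \<le> d\<close>,
    hence \<open>c / 2 \<le> c - h \<le> s \<le> d\<close>.\<close>
  have b: "\<bar>\<phi> r\<bar> \<le> M * indicator {c / 2..d} s" if "s \<le> r" "r \<le> s + h" "0 < s" for r s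
  proof (cases "r \<in> {c..d}")
    case True
    then show ?thesis using bound[of r] that h by (simp add: indicator_def)
  next
    case False
    then show ?thesis using bound[of r] M by (auto simp: indicator_def split: if_splits)
  qed
  show "admissible f"
  proof (rule admissibleI_bounded_support)
    show "0 < c / 2" using c by simp
    show "0 \<le> 2 * M / h" using h M by simp
    show "\<bar>f s\<bar> \<le> 2 * M / h * s * indicator {c / 2..d} s" if "0 \<le> s" for s
    proof (cases "s = 0")
      case True then show ?thesis by (simp add: f_def)
    next
      case False
      then have "\<bar>\<phi> s - \<phi> (s + h)\<bar> \<le> 2 * M * indicator {c / 2..d} s"
        using b[of s s] b[of s "s + h"] that h by (auto simp: indicator_def)
      then have "s / h * \<bar>\<phi> s - \<phi> (s + h)\<bar> \<le> s / h * (2 * M * indicator {c / 2..d} s)"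
        using that h by (intro mult_left_mono) auto
      then show ?thesis using that h by (simp add: f_def abs_mult mult_ac)
    qed
  qed simp
  have int: "integrable lborel \<phi>"
  proof (rule Bochner_Integration.integrable_bound)
    show "integrable lborel (\<lambda>s. M * indicat_real {c..d} s)"
      by (simp add: emeasure_lborel_Icc_eq)
    show "AE s in lborel. norm (\<phi> s) \<le> norm (M * indicat_real {c..d} s)"
    proof (rule AE_I2)
      fix s show "norm (\<phi> s) \<le> norm (M * indicat_real {c..d} s)"
        using bound[of s] by (auto simp: indicator_def)
    qed
  qed simp
  have ii: "integrable lborel (\<lambda>s. indicator {x..} s * \<phi> s)" for x
    using integrable_mult_indicator[OF _ int, of "{x..}"] by simp
  show eq: "hardy_adj f t = (1 / h) * integral {t..t + h} \<phi>" if t: "0 < t" for t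
  proof -
    \<comment> \<open>\<open>t \<le> s\<close> is equivalent to \<open>t + h \<le> h + s\<close>, so
      the second term is a translate of a tail. The form \<open>h + 1 * s\<close> fits the affine
      substitution.\<close>
    have "hardy_adj f t = (LINT s|lborel. (1 / h) * (indicator {t..} s * \<phi> s - indicator {t + h..} (h + 1 * s) * \<phi> (h + 1 * s)))"
      unfolding hardy_adj_borel[OF \<open>f \<in> borel_measurable borel\<close>] set_lebesgue_integral_def
      using t by (intro Bochner_Integration.integral_cong) (auto simp: f_def indicator_def add.commute)
    also have "\<dots> = (1 / h) * ((LINT s|lborel. indicator {t..} s * \<phi> s)
        - (LINT s|lborel. indicator {t + h..} (h + 1 * s) * \<phi> (h + 1 * s)))"
      using ii[of t] lborel_integrable_real_affine[OF ii[of "t + h"], of 1 h]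
      by (subst Bochner_Integration.integral_mult_right_zero, subst Bochner_Integration.integral_diff) auto
    also have "(LINT s|lborel. indicator {t + h..} (h + 1 * s) * \<phi> (h + 1 * s))
        = (LINT s|lborel. indicator {t + h..} s * \<phi> s)"
      using lborel_integral_real_affine[of 1 "\<lambda>s. indicator {t + h..} s * \<phi> s" h] by simp
    also have "(LINT s|lborel. indicator {t..} s * \<phi> s) - (LINT s|lborel. indicator {t + h..} s * \<phi> s)
        = (LINT s|lborel. indicator {t..} s * \<phi> s - indicator {t + h..} s * \<phi> s)"
      by (rule Bochner_Integration.integral_diff[symmetric]) (rule ii)+
    also have "\<dots> = (LINT s:{t..t + h}|lborel. \<phi> s)"
      unfolding set_lebesgue_integral_def
    proof (rule integral_cong_AE)
      \<comment> \<open>The two tails differ by the half-open interval, which lacks the endpoint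
        \<open>t + h\<close>.\<close>
      have "AE s in lborel. s \<noteq> t + h" by (rule AE_lborel_singleton)
      then show "AE s in lborel. indicator {t..} s * \<phi> s - indicator {t + h..} s * \<phi> s = indicator {t..t + h} s *\<^sub>R \<phi> s"
        by eventually_elim (use h in \<open>auto simp: indicator_def\<close>)
    qed simp_all
    also have "\<dots> = integral {t..t + h} \<phi>"
      by (rule set_borel_integral_eq_integral(2))
         (use integrable_mult_indicator[OF _ int, of "{t..t + h}"] in \<open>simp add: set_integrable_def\<close>)
    finally show ?thesis .
  qed
  show "\<bar>hardy_adj f t\<bar> \<le> M * indicator {c / 2..d} t" if t: "0 < t" for t
  proof -
    have "norm (integral {t..t + h} \<phi>) \<le> (M * indicator {c / 2..d} t) * (t + h - t)"
      using h t b continuous_on_subset[OF cont]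
      by (intro integral_bound) auto
    then show ?thesis using h by (simp add: eq[OF t] abs_mult field_simps)
  qed
qed

text \<open>The averages are difference quotients of the integral of \<open>\<phi>\<close> from
  \<open>t\<close>, so this is the fundamental theorem of calculus from the right. The bound
  \<open>h n \<le> 1\<close> keeps \<open>t + h n\<close> in the interval where the derivative is
  taken.\<close>

lemma moving_average_tendsto:
  fixes \<phi> :: "real \<Rightarrow> real"
  assumes cont: "continuous_on UNIV \<phi>" and h: "h \<longlonglongrightarrow> 0" "\<And>n. 0 < h n" "\<And>n. h n \<le> 1"
  shows "(\<lambda>n. (1 / h n) * integral {t..t + h n} \<phi>) \<longlonglongrightarrow> \<phi> t"
proof -
  have "((\<lambda>u. integral {t..u} \<phi>) has_real_derivative \<phi> t) (at t within {t..t + 1})"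
    by (rule integral_has_real_derivative) (use continuous_on_subset[OF cont] in auto)
  then have lim: "((\<lambda>u. (integral {t..u} \<phi> - integral {t..t} \<phi>) / (u - t)) \<longlongrightarrow> \<phi> t) (at t within {t..t + 1})"
    by (simp add: has_field_derivative_iff)
  have "filterlim (\<lambda>n. t + h n) (at t within {t..t + 1}) sequentially"
    unfolding filterlim_at
  proof
    show "\<forall>\<^sub>F n in sequentially. t + h n \<in> {t..t + 1} \<and> t + h n \<noteq> t"
      using h by (auto intro!: always_eventually simp: less_imp_le less_imp_neq[symmetric] add_increasing2)
    show "(\<lambda>n. t + h n) \<longlonglongrightarrow> t" using tendsto_add[OF tendsto_const h(1), of t] by simp
  qed
  from filterlim_compose[OF lim this] show ?thesis by simp
qed

lemma hardy_minus_id_le_of_admissible: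
  assumes p: "1 \<le> p" and a: "a < p - 1" and B: "B < \<infinity>"
    and adm: "\<And>f. admissible f \<Longrightarrow> weighted_integral p a (hardy f) \<le> B * weighted_integral p a (hardy_adj f)"
    and g [measurable]: "g \<in> borel_measurable borel" and fin: "weighted_integral p a g < \<infinity>"
  shows "weighted_integral p a (\<lambda>t. hardy g t - g t) \<le> B * weighted_integral p a g"
proof -
  \<comment> \<open>The hypothesis becomes an inequality in \<open>u\<close> alone. The value
    \<open>u 0\<close> may differ from \<open>hardy_adj f 0\<close>, but a single point does not
    affect the averages.\<close>
  have adm': "weighted_integral p a (\<lambda>t. hardy u t - u t) \<le> B * weighted_integral p a u"
    if f: "admissible f" and u: "u \<in> borel_measurable borel" "\<And>t. 0 < t \<Longrightarrow> u t = hardy_adj f t" for f u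
  proof -
    obtain v where v: "v \<in> borel_measurable borel" "\<And>t. 0 < t \<Longrightarrow> hardy_adj f t = v t"
      "\<And>t. 0 < t \<Longrightarrow> hardy f t = hardy v t - v t"
      by (rule admissible_hardy_adj[OF f]) (rule that)
    have uv: "0 < t \<Longrightarrow> u t = v t" for t using u v by simp
    have ne: "AE s in lborel. s \<noteq> (0::real)" by (rule AE_lborel_singleton)
    have "hardy u t = hardy v t" for t
    proof -
      have "(LINT s:{0..t}|lborel. u s) = (LINT s:{0..t}|lborel. v s)"
        unfolding set_lebesgue_integral_def using u v
        by (intro integral_cong_AE) (use ne in \<open>auto elim!: eventually_mono simp: indicator_def uv\<close>)
      then show ?thesis by (simp add: hardy_borel u v)
    qed
    then have "weighted_integral p a (\<lambda>t. hardy u t - u t) = weighted_integral p a (hardy f)"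
      using u v by (intro weighted_integral_cong) auto
    moreover have "weighted_integral p a (hardy_adj f) = weighted_integral p a u"
      using u by (intro weighted_integral_cong) auto
    ultimately show ?thesis using adm[OF f] by simp
  qed

  have smooth: "weighted_integral p a (\<lambda>t. hardy \<phi> t - \<phi> t) \<le> B * weighted_integral p a \<phi>"
    if cont: "continuous_on UNIV \<phi>" and c: "0 < c" and M: "0 \<le> M"
      and bound: "\<And>s. \<bar>\<phi> s\<bar> \<le> M * indicator {c..d} s" for \<phi> c d M
  proof -
    \<comment> \<open>The step size must be at most \<open>c / 2\<close> for the supports and at
      most 1 for the convergence of the averages.\<close>
    define e where "e = min (c / 2) 1"
    have e: "0 < e" "e \<le> c / 2" "e \<le> 1" using c by (auto simp: e_def)
    define h where "h = (\<lambda>n. e * inverse (real (Suc n)))"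
    have h: "0 < h n" "h n \<le> c / 2" "h n \<le> 1" for n
    proof -
      show "0 < h n" using e by (simp add: h_def)
      have "h n \<le> e * 1" unfolding h_def using e
        by (intro mult_left_mono) (auto intro!: inverse_le_1_iff[THEN iffD2])
      then show "h n \<le> c / 2" "h n \<le> 1" using e by auto
    qed
    have h0: "h \<longlonglongrightarrow> 0"
      unfolding h_def using tendsto_mult[OF tendsto_const LIMSEQ_inverse_real_of_nat, of e] by simp
    have [measurable]: "\<phi> \<in> borel_measurable borel"
      using cont by (rule borel_measurable_continuous_onI)
    define f where "f = (\<lambda>n s. s / h n * (\<phi> s - \<phi> (s + h n)))"
    have [measurable]: "f n \<in> borel_measurable borel" for n unfolding f_def by measurable
    have f_eq: "f n = (\<lambda>s. s / h n * (\<phi> s - \<phi> (s + h n)))" for n by (simp add: f_def)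
    note avg = moving_average_hardy_adj[OF cont c M bound h(1,2), folded f_eq]
    show ?thesis
    proof (rule hardy_minus_id_limit[OF p a B, where u = "\<lambda>n. hardy_adj (f n)" and k = "\<lambda>t. M * indicator {c / 2..d} t"])
      show "weighted_integral p a (\<lambda>t. M * indicator {c / 2..d} t) < \<infinity>"
        by (rule weighted_integral_bounded_support[OF p _ M, of "c / 2" _ d]) (use c M in auto)
      show "AE t in lborel. 0 < t \<longrightarrow> (\<lambda>n. hardy_adj (f n) t) \<longlonglongrightarrow> \<phi> t"
        using moving_average_tendsto[OF cont h0 h(1,3)] by (intro AE_I2 impI) (simp add: avg(2))
      show "\<bar>hardy_adj (f n) t\<bar> \<le> M * indicator {c / 2..d} t" if "0 < t" for n t
        using that by (rule avg(3))
      show "weighted_integral p a (\<lambda>t. hardy (hardy_adj (f n)) t - hardy_adj (f n) t)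
          \<le> B * weighted_integral p a (hardy_adj (f n))" for n
        by (rule adm'[OF avg(1)]) simp_all
    qed simp_all
  qed

  \<comment> \<open>A continuous profile that equals \<open>real n\<close> for
    \<open>2 / n \<le> t \<le> n - 1\<close> and vanishes for \<open>t \<le> 1 / n\<close> and for
    \<open>t \<ge> n\<close>, when \<open>n > 0\<close>.\<close>
  define bump where "bump = (\<lambda>n t::real. real n * (max 0 (min 1 (real n * t - 1)) * max 0 (min 1 (real n - t))))"
  have bump_cont: "continuous_on UNIV (bump n)" for n
    unfolding bump_def by (intro continuous_intros)
  have [measurable]: "bump n \<in> borel_measurable borel" for n
    using bump_cont by (rule borel_measurable_continuous_onI)
  \<comment> \<open>The left endpoint with \<open>Suc n\<close> is positive also for
    \<open>n = 0\<close>, where \<open>1 / real n\<close> would be 0.\<close>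
  have bump_bound: "0 \<le> bump n t" "bump n t \<le> real n * indicator {1 / real (Suc n)..real n} t" for n t
  proof -
    show "0 \<le> bump n t" by (simp add: bump_def)
    show "bump n t \<le> real n * indicator {1 / real (Suc n)..real n} t"
    proof (cases "t \<in> {1 / real (Suc n)..real n}")
      case True
      have "bump n t \<le> real n * (1 * 1)"
        unfolding bump_def by (intro mult_left_mono mult_mono) auto
      then show ?thesis using True by simp
    next
      case False
      have "real n * t - 1 \<le> 0" if "t < 1 / real (Suc n)"
      proof (cases "0 \<le> t")
        case True
        then have "real n * t \<le> real (Suc n) * t" by (intro mult_right_mono) auto
        moreover have "real (Suc n) * t < 1" using that by (simp add: field_simps)
        ultimately show ?thesis by simp
      next
        case False
        then have "real n * t \<le> 0" by (simp add: mult_nonneg_nonpos)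
        then show ?thesis by simp
      qed
      then have "bump n t = 0" using False by (auto simp: bump_def)
      then show ?thesis by (simp add: indicator_def)
    qed
  qed
  have bump_top: "\<forall>\<^sub>F n in sequentially. bump n t = real n" if t: "0 < t" for t
  proof -
    \<comment> \<open>This makes both \<open>real n * t - 1\<close> and \<open>real n - t\<close> at
      least 1 from \<open>N\<close> on, so both factors are capped at 1.\<close>
    obtain N where N: "2 / t + t + 1 \<le> real N" using real_arch_simple by blast
    have "bump n t = real n" if "n \<ge> N" for n
    proof -
      have n: "2 / t + t + 1 \<le> real n" using N that by linarith
      have "2 / t \<le> real n" using n t by linarith
      then have "2 \<le> real n * t" using t by (simp add: field_simps)
      moreover have "1 \<le> real n - t" using n t divide_nonneg_nonneg[of 2 t] by linarith
      ultimately show ?thesis by (simp add: bump_def)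
    qed
    then show ?thesis by (auto simp: eventually_sequentially)
  qed
  \<comment> \<open>Clamping to \<open>\<plusminus>bump n\<close> truncates height and support at
    once, preserves continuity and commutes with pointwise limits.\<close>
  define cut where "cut = (\<lambda>n u t. max (- bump n t) (min (bump n t) (u t)))"
  have cut_bound: "\<bar>cut n u t\<bar> \<le> bump n t" "\<bar>cut n u t\<bar> \<le> \<bar>u t\<bar>" for n u t
    using bump_bound(1)[of n t] by (auto simp: cut_def)
  have [measurable]: "cut n u \<in> borel_measurable borel" if [measurable]: "u \<in> borel_measurable borel" for n u
    unfolding cut_def by measurable
  have bump_fin: "weighted_integral p a (bump n) < \<infinity>" for n
    by (rule weighted_integral_bounded_support[OF p, of "1 / real (Suc n)" "real n" _ "real n"])
       (use bump_bound in auto)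

  \<comment> \<open>This yields continuous functions converging to \<open>g\<close> off a null set.
    They come without a common bound; \<open>cut\<close> supplies the domination.\<close>
  have "g measurable_on UNIV"
    using measurable_completion[of g lborel borel] g
    by (simp add: measurable_on_iff_borel_measurable)
  then obtain N q where N: "negligible N" and q: "\<And>n. continuous_on UNIV (q n)"
    and qlim: "\<And>x. x \<notin> N \<Longrightarrow> (\<lambda>n. q n x) \<longlonglongrightarrow> g x"
    unfolding measurable_on_def by auto
  have [measurable]: "q n \<in> borel_measurable borel" for n
    using q by (rule borel_measurable_continuous_onI)
  have aeN: "AE x in lborel. x \<notin> N"
    using AE_not_in[of N lebesgue] N by (simp add: negligible_iff_null_sets AE_completion_iff)

  \<comment> \<open>For fixed \<open>n\<close>, the limit in \<open>i\<close> passes from the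
    continuous \<open>cut n (q i)\<close> to \<open>cut n g\<close>, with majorant
    \<open>bump n\<close>.\<close>
  have step: "weighted_integral p a (\<lambda>t. hardy (cut n g) t - cut n g t) \<le> B * weighted_integral p a (cut n g)" for n
  proof (rule hardy_minus_id_limit[OF p a B, where u = "\<lambda>i. cut n (q i)" and k = "bump n"])
    show "AE t in lborel. 0 < t \<longrightarrow> (\<lambda>i. cut n (q i) t) \<longlonglongrightarrow> cut n g t"
      using aeN
    proof eventually_elim
      case (elim t)
      then show ?case unfolding cut_def by (intro impI tendsto_max tendsto_min tendsto_const qlim)
    qed
    show "weighted_integral p a (\<lambda>t. hardy (cut n (q i)) t - cut n (q i) t) \<le> B * weighted_integral p a (cut n (q i))" for i
    proof (rule smooth)
      show "continuous_on UNIV (cut n (q i))"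
        unfolding cut_def by (intro continuous_intros bump_cont q)
      show "\<bar>cut n (q i) s\<bar> \<le> real n * indicator {1 / real (Suc n)..real n} s" for s
        using cut_bound(1) bump_bound(2) by (rule order_trans)
    qed simp_all
    show "\<bar>cut n (q i) t\<bar> \<le> bump n t" for i t by (rule cut_bound(1))
    show "weighted_integral p a (bump n) < \<infinity>" by (rule bump_fin)
  qed simp_all
  \<comment> \<open>The truncation is removed by letting \<open>n\<close> tend to infinity, with
    majorant \<open>\<bar>g t\<bar>\<close>.\<close>
  show ?thesis
  proof (rule hardy_minus_id_limit[OF p a B, where u = "\<lambda>n. cut n g" and k = "\<lambda>t. \<bar>g t\<bar>"])
    show "AE t in lborel. 0 < t \<longrightarrow> (\<lambda>n. cut n g t) \<longlonglongrightarrow> g t"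
    proof (intro AE_I2 impI)
      fix t :: real assume "0 < t"
      obtain N where "\<bar>g t\<bar> \<le> real N" using real_arch_simple by blast
      then have "\<forall>\<^sub>F n in sequentially. \<bar>g t\<bar> \<le> real n"
        unfolding eventually_sequentially by (intro exI[of _ N]) auto
      with bump_top[OF \<open>0 < t\<close>] have "\<forall>\<^sub>F n in sequentially. cut n g t = g t"
        by eventually_elim (auto simp: cut_def)
      then show "(\<lambda>n. cut n g t) \<longlonglongrightarrow> g t" by (rule tendsto_eventually)
    qed
    show "weighted_integral p a (\<lambda>t. \<bar>g t\<bar>) < \<infinity>"
      using fin by (simp add: weighted_integral_def)
    show "\<bar>cut n g t\<bar> \<le> \<bar>g t\<bar>" for n t by (rule cut_bound(2))
  qed (simp_all add: step)
qed

section \<open>The inequality from the bound defining \<open>C_const\<close>, and sharpness from its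
  minimality\<close>

theorem proposition2p5:
  fixes p a :: real
  assumes "1 \<le> p" and "a < p - 1"
  shows "(\<forall>f. admissible f \<longrightarrow>
            weighted_integral p a (hardy f)
              \<le> ennreal (C_const p a powr p) * weighted_integral p a (hardy_adj f)) \<and>
         (\<forall>B::ennreal. B < ennreal (C_const p a powr p) \<longrightarrow>
            \<not> (\<forall>f. admissible f \<longrightarrow>
                  weighted_integral p a (hardy f) \<le> B * weighted_integral p a (hardy_adj f)))"
proof (intro conjI allI impI notI)
  fix f assume f: "admissible f"
  obtain g where g: "g \<in> borel_measurable borel" "\<And>t. 0 < t \<Longrightarrow> hardy_adj f t = g t"
    "\<And>t. 0 < t \<Longrightarrow> hardy f t = hardy g t - g t"
    by (rule admissible_hardy_adj[OF f]) (rule that)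
  have eqs: "weighted_integral p a (hardy f) = weighted_integral p a (\<lambda>t. hardy g t - g t)"
    "weighted_integral p a (hardy_adj f) = weighted_integral p a g"
    using g by (auto intro: weighted_integral_cong)
  show "weighted_integral p a (hardy f) \<le> ennreal (C_const p a powr p) * weighted_integral p a (hardy_adj f)"
  proof (cases "weighted_integral p a g < \<infinity>")
    case True
    have "g \<in> borel_measurable (lebesgue_on {0..})"
      using g(1) by (intro measurable_restrict_space1 measurable_completion) simp
    then show ?thesis
      using C_const_least(2)[OF assms] True unfolding hardy_minus_id_bound_def eqs by blast
  next
    case False
    then have "weighted_integral p a g = \<infinity>" by (simp add: less_top[symmetric])
    moreover have "0 < C_const p a powr p" using C_const_pos[OF assms] by simp
    ultimately show ?thesis by (simp add: eqs ennreal_mult_top)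
  qed
next
  fix B :: ennreal
  assume B: "B < ennreal (C_const p a powr p)"
    and adm: "\<forall>f. admissible f \<longrightarrow> weighted_integral p a (hardy f) \<le> B * weighted_integral p a (hardy_adj f)"
  have fin: "B < \<infinity>" using B by (rule less_trans) simp
  then obtain b where b: "0 \<le> b" "B = ennreal b" by (cases B) auto
  \<comment> \<open>Writing \<open>B\<close> as \<open>K powr p\<close> makes \<open>K\<close> a
    competitor in the definition of \<open>C_const\<close>, whose minimality then contradicts the
    choice of \<open>B\<close>.\<close>
  define K where "K = b powr (1 / p)"
  have K: "K powr p = b" using b assms by (simp add: K_def powr_powr)
  have "hardy_minus_id_bound p a K"
    by (rule hardy_minus_id_boundI)
       (use hardy_minus_id_le_of_admissible[OF assms fin] adm in \<open>auto simp: K b\<close>)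
  then have "C_const p a \<le> K"
    by (rule C_const_least(3)[OF assms, rotated]) (simp add: K_def)
  then have "C_const p a powr p \<le> K powr p"
    using C_const_least(1)[OF assms] assms by (intro powr_mono2) auto
  then show False using B b K by (simp add: ennreal_less_iff)
qed

end
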